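(* The set $\mathbf U=\{(x,q)\in\mathbb R^2: q\in(1,M+1],\ x\in\mathcal U_q\}$ is not closed, and its closure in $\mathbb R^2$ equals $\mathbf V\cup\{(0,1)\}$, where $\mathbf V=\{(x,q)\in\mathbb R^2: q\in(1,M+1],\ x\in\mathcal V_q\}$.
   Context: Fix a positive integer $M$ and $A=\{0,1,\dots,M\}$. A sequence in $A^{\mathbb N}$ is finite if it has a last nonzero digit, infinite otherwise; doubly infinite if both it and $(M-c_i)$ are infinite. For $q\in(1,M+1]$ an expansion of $x$ in base $q$ is $(c_i)\in A^{\mathbb N}$ with $\sum_{i\ge1}c_iq^{-i}=x$; $J_q=[0,M/(q-1)]$. $\mathcal U_q$ is the set of $x\in J_q$ having a unique expansion in base $q$. For $q<M+1$, $\mathcal V_q$ is the set of $x\in J_q$ having a unique doubly infinite expansion in base $q$; $\mathcal V_{M+1}=[0,1]$. *)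

theory Defs
  imports "HOL-Analysis.Analysis"
begin

text \<open>Digit sequences are indexed from 0: the value \<open>c i\<close> is the digit \<open>c\<^sub>i\<^sub>+\<^sub>1\<close> of the usual notation.\<close>

definition digit_seqs :: "nat \<Rightarrow> (nat \<Rightarrow> nat) set" where
  "digit_seqs M = {c. \<forall>i. c i \<in> {0..M}}"

text \<open>Having no last nonzero digit, the zero sequence counts as infinite.\<close>

definition finite_seq :: "(nat \<Rightarrow> nat) \<Rightarrow> bool" where
  "finite_seq c \<longleftrightarrow> (\<exists>n. c n \<noteq> 0 \<and> (\<forall>m>n. c m = 0))"

definition infinite_seq :: "(nat \<Rightarrow> nat) \<Rightarrow> bool" where
  "infinite_seq c \<longleftrightarrow> \<not> finite_seq c"

definition doubly_infinite_seq :: "nat \<Rightarrow> (nat \<Rightarrow> nat) \<Rightarrow> bool" where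
  "doubly_infinite_seq M c \<longleftrightarrow> infinite_seq c \<and> infinite_seq (\<lambda>i. M - c i)"

definition is_expansion :: "nat \<Rightarrow> real \<Rightarrow> real \<Rightarrow> (nat \<Rightarrow> nat) \<Rightarrow> bool" where
  "is_expansion M q x c \<longleftrightarrow>
     c \<in> digit_seqs M \<and> (\<lambda>i. real (c i) / q ^ Suc i) sums x"

definition J_set :: "nat \<Rightarrow> real \<Rightarrow> real set" where
  "J_set M q = {0 .. real M / (q - 1)}"

definition U_set :: "nat \<Rightarrow> real \<Rightarrow> real set" where
  "U_set M q = {x \<in> J_set M q. \<exists>!c. is_expansion M q x c}"

text \<open>The base \<open>M + 1\<close> is exceptional: there a number in \<open>(0, 1)\<close> with a finite expansion
  has no doubly infinite expansion.\<close>

definition V_set :: "nat \<Rightarrow> real \<Rightarrow> real set" where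
  "V_set M q =
     (if q = real M + 1 then {0..1}
      else {x \<in> J_set M q. \<exists>!c. is_expansion M q x c \<and> doubly_infinite_seq M c})"

definition U_graph :: "nat \<Rightarrow> (real \<times> real) set" where
  "U_graph M = {(x, q). q \<in> {1<..real M + 1} \<and> x \<in> U_set M q}"

definition V_graph :: "nat \<Rightarrow> (real \<times> real) set" where
  "V_graph M = {(x, q). q \<in> {1<..real M + 1} \<and> x \<in> V_set M q}"

end

theory Submission
  imports Defs
begin

text \<open>
  If \<open>c\<close> is an expansion of \<open>x\<close> in base \<open>q\<close>, its \<open>n\<close>-th tail has a value in
  \<open>J\<^sub>q = [0, L]\<close>, \<open>L = M / (q - 1)\<close>, that depends continuously on \<open>(x, q)\<close>; conversely a prefix
  extends to an expansion of \<open>x\<close> as soon as its tail value lies in \<open>[0, L]\<close>, and for \<open>q < M + 1\<close>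
  to a doubly infinite one if the tail value lies in \<open>(0, L)\<close>.

  If \<open>x\<close> has two doubly infinite expansions in base \<open>q\<close>, their tail values just behind the first
  difference lie in the open interval, so both prefixes still extend for all \<open>(x', q')\<close> near
  \<open>(x, q)\<close>, which is therefore not in the closure of \<open>\<^bold>U\<close>. For \<open>q \<le> 3/2\<close> only the end points of
  \<open>J\<^sub>q\<close> are univoque, which gives the single limit point \<open>(0, 1)\<close>.

  Conversely, if \<open>c\<close> is the unique doubly infinite expansion of \<open>x\<close> in base \<open>q < M + 1\<close>, then
  \<open>c\<^sub>n < M\<close> forces the tail value behind \<open>c\<^sub>n\<close> to be at most \<open>1\<close>, and symmetrically for \<open>c\<^sub>n > 0\<close>.
  In a slightly larger base \<open>q'\<close> these inequalities become strict, so \<open>c\<close> is the only expansion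
  of its value in base \<open>q'\<close>. In base \<open>M + 1\<close> every irrational number in \<open>[0, 1]\<close> is univoque.
\<close>

section \<open>Tails of expansions\<close>

text \<open>In closed form this is \<open>q ^ n * (x - (\<Sum>i<n. c i / q ^ Suc i))\<close>, the
  value the \<open>n\<close>-th tail must have if \<open>c\<close> expands \<open>x\<close>. The
  recursion presupposes no expansion and reads only the digits before \<open>n\<close>, so a prefix
  can be tested against any point and base.\<close>

fun tail_val :: "(nat \<Rightarrow> nat) \<Rightarrow> real \<Rightarrow> real \<Rightarrow> nat \<Rightarrow> real" where
  "tail_val c q x 0 = x"
| "tail_val c q x (Suc n) = q * tail_val c q x n - real (c n)"

lemma tail_val_cong: "(\<And>i. i < n \<Longrightarrow> c i = d i) \<Longrightarrow> tail_val c q x n = tail_val d q x n"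
  by (induction n) auto

lemma is_expansion_Suc_shift:
  assumes "q > 1"
  shows "is_expansion M q x c \<longleftrightarrow>
           c 0 \<le> M \<and> is_expansion M q (q * x - real (c 0)) (\<lambda>i. c (Suc i))"
proof -
  have dig: "c \<in> digit_seqs M \<longleftrightarrow> c 0 \<le> M \<and> (\<lambda>i. c (Suc i)) \<in> digit_seqs M"
    by (auto simp: digit_seqs_def) (metis not0_implies_Suc)
  have "(\<lambda>i. real (c i) / q ^ Suc i) sums x \<longleftrightarrow>
        (\<lambda>i. real (c (Suc i)) / q ^ Suc (Suc i)) sums (x - real (c 0) / q)"
    using sums_Suc_iff[of "\<lambda>i. real (c i) / q ^ Suc i" "x - real (c 0) / q"] by simp
  also have "\<dots> \<longleftrightarrow> (\<lambda>i. q * (real (c (Suc i)) / q ^ Suc (Suc i))) sums (q * (x - real (c 0) / q))"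
    using assms by (subst sums_mult_iff) auto
  also have "(\<lambda>i. q * (real (c (Suc i)) / q ^ Suc (Suc i))) = (\<lambda>i. real (c (Suc i)) / q ^ Suc i)"
    using assms by auto
  also have "q * (x - real (c 0) / q) = q * x - real (c 0)"
    using assms by (simp add: algebra_simps)
  finally show ?thesis
    unfolding is_expansion_def using dig by blast
qed

text \<open>Read from left to right, this makes every tail an expansion of its tail value; from
  right to left, it glues a prefix to an expansion of the tail value.\<close>

lemma is_expansion_shift:
  assumes "q > 1"
  shows "is_expansion M q x c \<longleftrightarrow>
           (\<forall>i<n. c i \<le> M) \<and> is_expansion M q (tail_val c q x n) (\<lambda>i. c (i + n))"
proof (induction n)
  case (Suc n)
  show ?case
    using Suc.IH is_expansion_Suc_shift[OF assms, of M "tail_val c q x n" "\<lambda>i. c (i + n)"]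
    by (auto simp: less_Suc_eq)
qed simp

lemma is_expansion_le: "is_expansion M q x c \<Longrightarrow> c i \<le> M"
  by (auto simp: is_expansion_def digit_seqs_def)

lemma is_expansion_top:
  assumes "q > 1"
  shows "is_expansion M q (real M / (q - 1)) (\<lambda>_. M)"
proof -
  have "(\<lambda>i. (1 / q) ^ i) sums (1 / (1 - 1 / q))"
    using assms by (intro geometric_sums) auto
  then have s: "(\<lambda>i. real M / q * (1 / q) ^ i) sums (real M / q * (1 / (1 - 1 / q)))"
    by (rule sums_mult)
  have e1: "real M / q * (1 / (1 - 1 / q)) = real M / (q - 1)"
    using assms by (simp add: field_simps)
  have e2: "(\<lambda>i. real M / q * (1 / q) ^ i) = (\<lambda>i. real M / q ^ Suc i)"
    by (simp add: power_divide)
  show ?thesis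
    using s unfolding is_expansion_def e1 e2 by (simp add: digit_seqs_def)
qed

text \<open>Subtract the series of \<open>c\<close> from that of the constant sequence
  \<open>M\<close>. This symmetry derives upper bounds from lower ones throughout.\<close>

lemma is_expansion_reflect:
  assumes "q > 1" "is_expansion M q x c"
  shows "is_expansion M q (real M / (q - 1) - x) (\<lambda>i. M - c i)"
proof -
  have "(\<lambda>i. real M / q ^ Suc i - real (c i) / q ^ Suc i) sums (real M / (q - 1) - x)"
    using is_expansion_top[OF assms(1), of M] assms(2)
    by (intro sums_diff) (auto simp: is_expansion_def)
  moreover have "real M / q ^ Suc i - real (c i) / q ^ Suc i = real (M - c i) / q ^ Suc i" for i
    using is_expansion_le[OF assms(2), of i] by (simp add: of_nat_diff diff_divide_distrib)
  ultimately show ?thesis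
    by (simp add: is_expansion_def digit_seqs_def)
qed

lemma is_expansion_bounds:
  assumes "q > 1" "is_expansion M q x c"
  shows "0 \<le> x" "x \<le> real M / (q - 1)"
proof -
  have "0 \<le> y" if "is_expansion M q y d" for y d
    using that assms(1) sums_le[of "\<lambda>_. 0" "\<lambda>i. real (d i) / q ^ Suc i" 0 y]
    by (auto simp: is_expansion_def)
  from this[OF assms(2)] this[OF is_expansion_reflect[OF assms]]
  show "0 \<le> x" "x \<le> real M / (q - 1)" by auto
qed

lemma tail_val_bounds:
  assumes "q > 1" "is_expansion M q x c"
  shows "0 \<le> tail_val c q x n" "tail_val c q x n \<le> real M / (q - 1)"
  using is_expansion_bounds[OF assms(1)] is_expansion_shift[OF assms(1), of M x c n] assms(2)
  by auto

text \<open>The point \<open>L = M / (q - 1)\<close> is fixed under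
  \<open>y \<mapsto> q * y - M\<close>.\<close>

lemma tail_val_reflect:
  assumes "q > 1" "\<And>i. i < n \<Longrightarrow> c i \<le> M"
  shows "tail_val (\<lambda>i. M - c i) q (real M / (q - 1) - x) n = real M / (q - 1) - tail_val c q x n"
  using assms(2)
proof (induction n)
  case (Suc n)
  have "real (M - c n) = real M - real (c n)"
    using Suc.prems by (simp add: of_nat_diff)
  moreover have "q * (real M / (q - 1)) - real M = real M / (q - 1)"
    using assms(1) by (simp add: field_simps)
  ultimately show ?case
    using Suc by (simp add: right_diff_distrib)
qed simp

lemma is_expansion_0_iff:
  assumes "q > 1"
  shows "is_expansion M q 0 c \<longleftrightarrow> c = (\<lambda>_. 0)"
proof
  assume *: "is_expansion M q 0 c"
  then have s: "(\<lambda>i. real (c i) / q ^ Suc i) sums 0" by (simp add: is_expansion_def)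
  then have "(\<Sum>i. real (c i) / q ^ Suc i) = 0" "summable (\<lambda>i. real (c i) / q ^ Suc i)"
    by (auto simp: sums_iff)
  then have "\<forall>i. real (c i) / q ^ Suc i = 0"
    using assms by (subst (asm) suminf_eq_zero_iff) auto
  then show "c = (\<lambda>_. 0)" using assms by auto
qed (simp add: is_expansion_def digit_seqs_def)

section \<open>Finite and doubly infinite sequences in terms of tail values\<close>

lemma finite_seq_tail_val_0:
  assumes "q > 1" "is_expansion M q x c" "finite_seq c"
  obtains N where "\<And>m. m \<ge> N \<Longrightarrow> tail_val c q x m = 0"
proof -
  obtain n where n: "\<forall>m>n. c m = 0" using assms(3) by (auto simp: finite_seq_def)
  have "tail_val c q x m = 0" if "m \<ge> Suc n" for m
  proof -
    have "is_expansion M q (tail_val c q x m) (\<lambda>i. c (i + m))"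
      using assms is_expansion_shift by blast
    then have "(\<lambda>_. 0) sums tail_val c q x m"
      using n that by (simp add: is_expansion_def)
    then show ?thesis by (rule sums_unique2[OF _ sums_zero])
  qed
  then show thesis using that by blast
qed

lemma finite_seqI_tail_val:
  assumes "q > 1" "is_expansion M q x c" "tail_val c q x (Suc n) = 0" "c n > 0"
  shows "finite_seq c"
proof -
  have "is_expansion M q 0 (\<lambda>i. c (i + Suc n))"
    using is_expansion_shift[OF assms(1), of M x c "Suc n"] assms(2,3) by simp
  then have z: "(\<lambda>i. c (i + Suc n)) = (\<lambda>_. 0)" using is_expansion_0_iff assms(1) by blast
  have "c m = 0" if "m > n" for m
    using fun_cong[OF z, of "m - Suc n"] that by simp
  then show ?thesis unfolding finite_seq_def using assms(4) by blast
qed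

text \<open>If \<open>c\<close> is finite its tail values are eventually 0; if its reflection is
  finite they are eventually \<open>M / (q - 1)\<close>.\<close>

lemma doubly_infinite_seqI_tail_val:
  assumes "q > 1" "is_expansion M q x c"
    and "\<And>m. m \<ge> n \<Longrightarrow> tail_val c q x m \<in> {0 <..< real M / (q - 1)}"
  shows "doubly_infinite_seq M c"
proof -
  have "\<not> finite_seq c"
  proof
    assume "finite_seq c"
    then obtain N where "\<And>m. m \<ge> N \<Longrightarrow> tail_val c q x m = 0"
      using finite_seq_tail_val_0 assms by blast
    then show False using assms(3)[of "max n N"] by simp
  qed
  moreover have "\<not> finite_seq (\<lambda>i. M - c i)"
  proof
    assume "finite_seq (\<lambda>i. M - c i)"
    then obtain N where "\<And>m. m \<ge> N \<Longrightarrow> tail_val (\<lambda>i. M - c i) q (real M / (q - 1) - x) m = 0"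
      using finite_seq_tail_val_0 is_expansion_reflect assms by blast
    then show False
      using assms(3)[of "max n N"] tail_val_reflect[of q "max n N" c M x] assms(1)
        is_expansion_le[OF assms(2)] by simp
  qed
  ultimately show ?thesis by (simp add: doubly_infinite_seq_def infinite_seq_def)
qed

text \<open>These serve the two end points of \<open>J_set M q\<close>, which the construction
  inside the open interval does not reach.\<close>

lemma doubly_infinite_const: "doubly_infinite_seq M (\<lambda>_. 0)" "doubly_infinite_seq M (\<lambda>_. M)"
  unfolding doubly_infinite_seq_def infinite_seq_def finite_seq_def by auto

section \<open>Existence of expansions with prescribed prefix\<close>

text \<open>The \<open>n\<close>-th partial sum misses \<open>x\<close> by the tail value divided by
  \<open>q ^ n\<close>, which tends to 0 when the tail values stay bounded.\<close>

lemma is_expansionI_tail_val: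
  assumes "q > 1" "\<And>i. c i \<le> M" "\<And>n. \<bar>tail_val c q x n\<bar> \<le> B"
  shows "is_expansion M q x c"
proof -
  have part: "(\<Sum>i<n. real (c i) / q ^ Suc i) = x - tail_val c q x n * (1 / q) ^ n" for n
  proof (induction n)
    case (Suc n)
    have "tail_val c q x (Suc n) * (1 / q) ^ Suc n
        = tail_val c q x n * (1 / q) ^ n - real (c n) / q ^ Suc n"
      using assms(1) by (simp add: power_divide diff_divide_distrib left_diff_distrib)
    then show ?case using Suc.IH by (simp del: tail_val.simps)
  qed simp
  have "(\<lambda>n. B * (1 / q) ^ n) \<longlonglongrightarrow> B * 0"
    using assms(1) by (intro tendsto_mult tendsto_const LIMSEQ_power_zero) auto
  then have "(\<lambda>n. B * (1 / q) ^ n) \<longlonglongrightarrow> 0" by simp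
  then have "(\<lambda>n. tail_val c q x n * (1 / q) ^ n) \<longlonglongrightarrow> 0"
  proof (rule Lim_null_comparison[rotated], intro always_eventually allI)
    fix n
    show "norm (tail_val c q x n * (1 / q) ^ n) \<le> B * (1 / q) ^ n"
      using assms(1) assms(3)[of n] by (simp add: abs_mult power_abs divide_right_mono)
  qed
  then have "(\<lambda>n. x - tail_val c q x n * (1 / q) ^ n) \<longlonglongrightarrow> x - 0"
    by (intro tendsto_diff tendsto_const)
  then show ?thesis
    unfolding is_expansion_def sums_def part using assms(2) by (simp add: digit_seqs_def)
qed

text \<open>Choose for every point of \<open>S\<close> a digit that keeps it in \<open>S\<close> and
  follow the orbit of \<open>x\<close>. The set \<open>S\<close> will be the closed or the open
  interval between 0 and \<open>M / (q - 1)\<close>.\<close>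

lemma expansion_exists_in_invariant_set:
  assumes "q > 1" "x \<in> S" "S \<subseteq> {0 .. real M / (q - 1)}"
    and step: "\<And>y. y \<in> S \<Longrightarrow> \<exists>d\<le>M. q * y - real d \<in> S"
  obtains c where "is_expansion M q x c" "\<And>n. tail_val c q x n \<in> S"
proof -
  obtain f where f: "\<And>y. y \<in> S \<Longrightarrow> f y \<le> M \<and> q * y - real (f y) \<in> S"
    using step by metis
  define t where "t = rec_nat x (\<lambda>_ y. q * y - real (f y))"
  have t: "t 0 = x" "\<And>n. t (Suc n) = q * t n - real (f (t n))" by (simp_all add: t_def)
  define c where "c = (\<lambda>n. f (t n))"
  have tS: "t n \<in> S" for n
    by (induction n) (use assms(2) f t in auto)
  have tv: "tail_val c q x n = t n" for n
    by (induction n) (auto simp: t c_def)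
  have "is_expansion M q x c"
  proof (rule is_expansionI_tail_val[where B = "real M / (q - 1)"])
    show "c i \<le> M" for i using f tS c_def by auto
    show "\<bar>tail_val c q x n\<bar> \<le> real M / (q - 1)" for n
      using tS[of n] assms(3) unfolding tv by force
  qed fact
  then show thesis using that tv tS by simp
qed

lemma expansion_exists:
  assumes "1 < q" "q \<le> real M + 1" "x \<in> {0 .. real M / (q - 1)}"
  obtains c where "is_expansion M q x c"
proof -
  let ?L = "real M / (q - 1)"
  have L1: "?L \<ge> 1" using assms by (simp add: field_simps)
  have qL: "q * ?L = real M + ?L" using assms(1) by (simp add: field_simps)
  have "\<exists>d\<le>M. q * y - real d \<in> {0 .. ?L}" if y: "y \<in> {0 .. ?L}" for y
  proof (cases "q * y \<le> ?L")
    case True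
    then show ?thesis using y assms(1) by (intro exI[of _ 0]) auto
  next
    case False
    \<comment> \<open>The least digit with \<open>q * y - d \<le> ?L\<close>; minimality gives
      \<open>q * y - d > ?L - 1 \<ge> 0\<close>.\<close>
    define d where "d = nat \<lceil>q * y - ?L\<rceil>"
    have "q * y \<le> q * ?L" using y assms(1) by (intro mult_left_mono) auto
    then have "q * y - ?L \<le> real M" using qL by linarith
    then have "\<lceil>q * y - ?L\<rceil> \<le> int M" by (simp add: ceiling_le_iff)
    then have "d \<le> M" unfolding d_def by linarith
    moreover have "real d = of_int \<lceil>q * y - ?L\<rceil>"
      using False unfolding d_def by simp
    ultimately show ?thesis
      using L1 by (intro exI[of _ d]) (simp, linarith)
  qed
  then show thesis
    using that expansion_exists_in_invariant_set[OF assms(1,3) subset_refl] by blast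
qed

lemma interior_expansion_exists:
  assumes "1 < q" "q < real M + 1" "x \<in> {0 <..< real M / (q - 1)}"
  obtains c where "is_expansion M q x c" "\<And>n. tail_val c q x n \<in> {0 <..< real M / (q - 1)}"
proof -
  let ?L = "real M / (q - 1)"
  have L1: "?L > 1" using assms by (simp add: field_simps)
  have qL: "q * ?L = real M + ?L" using assms(1) by (simp add: field_simps)
  have "\<exists>d\<le>M. q * y - real d \<in> {0 <..< ?L}" if y: "y \<in> {0 <..< ?L}" for y
  proof (cases "q * y < ?L")
    case True
    then show ?thesis using y assms(1) by (intro exI[of _ 0]) auto
  next
    case False
    \<comment> \<open>Floor plus one replaces the ceiling to get \<open>q * y - d < ?L\<close>
      strictly; the lower bound is now \<open>?L - 1\<close>, positive because
      \<open>q < M + 1\<close>.\<close>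
    define d where "d = nat (\<lfloor>q * y - ?L\<rfloor> + 1)"
    have "q * y < q * ?L" using y assms(1) by (intro mult_strict_left_mono) auto
    then have "q * y - ?L < real M" using qL by linarith
    then have "\<lfloor>q * y - ?L\<rfloor> < int M" by (simp add: floor_less_iff)
    then have "d \<le> M" unfolding d_def by linarith
    moreover have "real d = of_int \<lfloor>q * y - ?L\<rfloor> + 1"
      using False unfolding d_def by simp
    ultimately show ?thesis
      using L1 by (intro exI[of _ d]) (simp, linarith)
  qed
  moreover have "{0 <..< ?L} \<subseteq> {0 .. ?L}" by auto
  ultimately show thesis
    using that expansion_exists_in_invariant_set[OF assms(1,3)] by blast
qed

text \<open>The second claim carries the location of the tails of \<open>e\<close> over to the
  spliced sequence, as is needed to see that it is doubly infinite.\<close>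

lemma splice:
  assumes "q > 1" "\<And>i. i < n \<Longrightarrow> c i \<le> M" "is_expansion M q (tail_val c q x n) e"
  defines "d \<equiv> \<lambda>i. if i < n then c i else e (i - n)"
  shows "is_expansion M q x d" "tail_val d q x (k + n) = tail_val e q (tail_val c q x n) k"
proof -
  have eq: "tail_val d q x n = tail_val c q x n"
    by (rule tail_val_cong) (simp add: d_def)
  then show "is_expansion M q x d"
    using assms(1-3) by (subst is_expansion_shift[where n = n]) (auto simp: d_def)
  show "tail_val d q x (k + n) = tail_val e q (tail_val c q x n) k"
  proof (induction k)
    case 0
    show ?case using eq by simp
  next
    case (Suc k)
    moreover have "d (k + n) = e k" by (simp add: d_def)
    ultimately show ?case by simp
  qed
qed

lemma prefix_extends:
  assumes "1 < q" "q \<le> real M + 1" "\<And>i. i < n \<Longrightarrow> c i \<le> M"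
    and "tail_val c q x n \<in> {0 .. real M / (q - 1)}"
  obtains d where "is_expansion M q x d" "\<And>i. i < n \<Longrightarrow> d i = c i"
proof -
  obtain e where "is_expansion M q (tail_val c q x n) e"
    using expansion_exists assms by blast
  from splice(1)[OF assms(1,3) this] show thesis
    using that[of "\<lambda>i. if i < n then c i else e (i - n)"] by auto
qed

lemma prefix_extends_doubly_infinite:
  assumes "1 < q" "q < real M + 1" "\<And>i. i < n \<Longrightarrow> c i \<le> M"
    and "tail_val c q x n \<in> {0 <..< real M / (q - 1)}"
  obtains d where "is_expansion M q x d" "doubly_infinite_seq M d" "\<And>i. i < n \<Longrightarrow> d i = c i"
proof -
  obtain e where e: "is_expansion M q (tail_val c q x n) e"
    "\<And>k. tail_val e q (tail_val c q x n) k \<in> {0 <..< real M / (q - 1)}"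
    using interior_expansion_exists assms(1,2,4) by blast
  let ?d = "\<lambda>i. if i < n then c i else e (i - n)"
  have "doubly_infinite_seq M ?d"
  proof (rule doubly_infinite_seqI_tail_val[OF assms(1)])
    show "is_expansion M q x ?d" using splice(1) assms e by blast
    fix m assume "m \<ge> n"
    then show "tail_val ?d q x m \<in> {0 <..< real M / (q - 1)}"
      using splice(2)[OF assms(1,3) e(1), of "m - n"] e(2)[of "m - n"] by simp
  qed
  moreover have "is_expansion M q x ?d" using splice(1) assms e by blast
  ultimately show thesis using that[of ?d] by auto
qed

lemma doubly_infinite_expansion_exists:
  assumes "1 < q" "q < real M + 1" "x \<in> {0 .. real M / (q - 1)}"
  obtains c where "is_expansion M q x c" "doubly_infinite_seq M c"
proof -
  consider "x = 0" | "x = real M / (q - 1)" | "x \<in> {0 <..< real M / (q - 1)}"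
    using assms(3) by fastforce
  then show thesis
  proof cases
    case 1
    then have "is_expansion M q x (\<lambda>_. 0)" using is_expansion_0_iff[OF assms(1)] by simp
    then show ?thesis using that doubly_infinite_const(1) by blast
  next
    case 2
    then have "is_expansion M q x (\<lambda>_. M)" using is_expansion_top[OF assms(1)] by simp
    then show ?thesis using that doubly_infinite_const(2) by blast
  next
    case 3
    then show ?thesis
      using prefix_extends_doubly_infinite[OF assms(1,2), of 0 "\<lambda>_. 0" x] that by auto
  qed
qed

section \<open>Uniqueness in terms of tails\<close>

text \<open>The tail values agree up to the first difference, so just behind it they are apart by
  the digit gap, which is at least 1 in absolute value.\<close>

lemma first_difference:
  assumes "c \<noteq> (d :: nat \<Rightarrow> nat)"
  obtains n where "c n \<noteq> d n" "\<And>i. i < n \<Longrightarrow> c i = d i"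
    "\<And>q x. tail_val c q x (Suc n) - tail_val d q x (Suc n) = real (d n) - real (c n)"
proof -
  define n where "n = (LEAST n. c n \<noteq> d n)"
  have 1: "c n \<noteq> d n" unfolding n_def by (rule LeastI_ex) (use assms in auto)
  have 2: "c i = d i" if "i < n" for i using that not_less_Least unfolding n_def by blast
  have 3: "tail_val c q x (Suc n) - tail_val d q x (Suc n) = real (d n) - real (c n)" for q x
    using tail_val_cong[of n c d q x] 2 by simp
  show thesis by (rule that) (fact 1 2 3)+
qed

text \<open>A second expansion would have, behind the first difference, a tail value at least 1
  below or above that of \<open>c\<close>; the two bounds push it out of
  \<open>[0, L]\<close>.\<close>

lemma U_setI:
  assumes "q > 1" "is_expansion M q x c"
    and up: "\<And>n. c n < M \<Longrightarrow> tail_val c q x (Suc n) < 1"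
    and down: "\<And>n. c n > 0 \<Longrightarrow> real M / (q - 1) - tail_val c q x (Suc n) < 1"
  shows "x \<in> U_set M q"
proof -
  have "d = c" if d: "is_expansion M q x d" for d
  proof (rule ccontr)
    assume "d \<noteq> c"
    then obtain n where n: "c n \<noteq> d n"
      "tail_val c q x (Suc n) - tail_val d q x (Suc n) = real (d n) - real (c n)"
      using first_difference[of c d] by metis
    show False
    proof (cases "c n < d n")
      case True
      then have "real (d n) - real (c n) \<ge> 1" "c n < M"
        using is_expansion_le[OF d, of n] by auto
      then show False using n(2) up[of n] tail_val_bounds(1)[OF assms(1) d, of "Suc n"] by linarith
    next
      case False
      then have "real (c n) - real (d n) \<ge> 1" "c n > 0"
        using n(1) by auto
      then show False using n(2) down[of n] tail_val_bounds(2)[OF assms(1) d, of "Suc n"] by linarith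
    qed
  qed
  then show ?thesis
    using assms(2) is_expansion_bounds[OF assms(1,2)] unfolding U_set_def J_set_def by auto
qed

lemma tail_val_upd: "tail_val (c(n := k)) q x (Suc n) = tail_val c q x (Suc n) + real (c n) - real k"
  using tail_val_cong[of n "c(n := k)" c q x] by simp

text \<open>Otherwise digit \<open>n\<close> can be raised or lowered by 1 with the new tail value
  still in \<open>[0, L]\<close>, and the altered prefix extends to a second expansion.\<close>

lemma U_setD:
  assumes "1 < q" "q \<le> real M + 1" "x \<in> U_set M q" "is_expansion M q x c"
  shows "c n < M \<Longrightarrow> tail_val c q x (Suc n) < 1"
    and "c n > 0 \<Longrightarrow> real M / (q - 1) - tail_val c q x (Suc n) < 1"
proof -
  note b = tail_val_bounds[OF assms(1,4), of "Suc n"]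
  have no: False if "k \<le> M" "k \<noteq> c n"
    "tail_val c q x (Suc n) + real (c n) - real k \<in> {0 .. real M / (q - 1)}" for k
  proof -
    have "(c(n := k)) i \<le> M" for i using that(1) is_expansion_le[OF assms(4)] by simp
    moreover have "tail_val (c(n := k)) q x (Suc n) \<in> {0 .. real M / (q - 1)}"
      using that(3) unfolding tail_val_upd .
    ultimately obtain d where d: "is_expansion M q x d"
      "\<And>i. i < Suc n \<Longrightarrow> d i = (c(n := k)) i"
      using prefix_extends[OF assms(1,2)] by blast
    then have "d n \<noteq> c n" using that(2) by simp
    moreover have "d = c" using assms(3,4) d(1) unfolding U_set_def by blast
    ultimately show False by simp
  qed
  show "tail_val c q x (Suc n) < 1" if "c n < M"
  proof (rule ccontr)
    assume "\<not> tail_val c q x (Suc n) < 1"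
    then show False using no[of "Suc (c n)"] that b by auto
  qed
  show "real M / (q - 1) - tail_val c q x (Suc n) < 1" if "c n > 0"
  proof (rule ccontr)
    assume "\<not> real M / (q - 1) - tail_val c q x (Suc n) < 1"
    moreover have "real (c n - 1) = real (c n) - 1" using that by (simp add: of_nat_diff)
    ultimately have "tail_val c q x (Suc n) + real (c n) - real (c n - 1) \<in> {0 .. real M / (q - 1)}"
      using b(1) unfolding atLeastAtMost_iff by (intro conjI) linarith+
    then show False
      using no[of "c n - 1"] that is_expansion_le[OF assms(4), of n] by linarith
  qed
qed

text \<open>The argument is that of \<open>U_setD\<close>, but only tail values in the open interval
  yield a doubly infinite extension. An altered tail value at an end point is no contradiction,
  hence the non-strict bounds.\<close>

lemma V_setD:
  assumes "1 < q" "q < real M + 1" "x \<in> V_set M q"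
    and c: "is_expansion M q x c" "doubly_infinite_seq M c"
  shows "c n < M \<Longrightarrow> tail_val c q x (Suc n) \<le> 1"
    and "c n > 0 \<Longrightarrow> real M / (q - 1) - tail_val c q x (Suc n) \<le> 1"
proof -
  note b = tail_val_bounds[OF assms(1) c(1), of "Suc n"]
  have uniq: "d = c" if "is_expansion M q x d" "doubly_infinite_seq M d" for d
    using assms(2,3) c that unfolding V_set_def by auto
  have no: False if "k \<le> M" "k \<noteq> c n"
    "tail_val c q x (Suc n) + real (c n) - real k \<in> {0 <..< real M / (q - 1)}" for k
  proof -
    have "(c(n := k)) i \<le> M" for i using that(1) is_expansion_le[OF c(1)] by simp
    moreover have "tail_val (c(n := k)) q x (Suc n) \<in> {0 <..< real M / (q - 1)}"
      using that(3) unfolding tail_val_upd .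
    ultimately obtain d where d: "is_expansion M q x d" "doubly_infinite_seq M d"
      "\<And>i. i < Suc n \<Longrightarrow> d i = (c(n := k)) i"
      using prefix_extends_doubly_infinite[OF assms(1,2)] by blast
    then have "d n \<noteq> c n" using that(2) by simp
    then show False using uniq d by blast
  qed
  show "tail_val c q x (Suc n) \<le> 1" if "c n < M"
  proof (rule ccontr)
    assume "\<not> tail_val c q x (Suc n) \<le> 1"
    then show False using no[of "Suc (c n)"] that b by auto
  qed
  show "real M / (q - 1) - tail_val c q x (Suc n) \<le> 1" if "c n > 0"
  proof (rule ccontr)
    assume "\<not> real M / (q - 1) - tail_val c q x (Suc n) \<le> 1"
    moreover have "real (c n - 1) = real (c n) - 1" using that by (simp add: of_nat_diff)
    ultimately have "tail_val c q x (Suc n) + real (c n) - real (c n - 1) \<in> {0 <..< real M / (q - 1)}"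
      using b(1) unfolding greaterThanLessThan_iff by (intro conjI) linarith+
    then show False
      using no[of "c n - 1"] that is_expansion_le[OF c(1), of n] by linarith
  qed
qed

section \<open>The closure is contained in \<open>\<^bold>V \<union> {(0, 1)}\<close>\<close>

lemma U_set_reflect:
  assumes "q > 1" "x \<in> U_set M q"
  shows "real M / (q - 1) - x \<in> U_set M q"
proof -
  let ?L = "real M / (q - 1)"
  obtain c where c: "is_expansion M q x c" "\<And>d. is_expansion M q x d \<Longrightarrow> d = c"
    using assms(2) unfolding U_set_def by blast
  have "d = (\<lambda>i. M - c i)" if d: "is_expansion M q (?L - x) d" for d
  proof
    fix i
    have "is_expansion M q x (\<lambda>i. M - d i)"
      using is_expansion_reflect[OF assms(1) d] by simp
    then have "c i = M - d i" using c(2) by metis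
    then show "d i = M - c i" using is_expansion_le[OF d, of i] by simp
  qed
  moreover have "is_expansion M q (?L - x) (\<lambda>i. M - c i)"
    by (rule is_expansion_reflect) fact+
  moreover have "?L - x \<in> J_set M q"
    using assms(2) unfolding U_set_def J_set_def by auto
  ultimately show ?thesis unfolding U_set_def by blast
qed

text \<open>Here \<open>L \<ge> 2\<close>, so the two bounds of \<open>U_setD\<close> exclude each
  other and every digit is 0 or \<open>M\<close>. A 0 right after an \<open>M\<close> would follow a
  tail value above 1, which multiplication by \<open>q\<close> cannot bring below 1.\<close>

lemma U_set_digits_const_of_small_base:
  assumes "M > 0" "1 < q" "q \<le> 3/2" "x \<in> U_set M q" "is_expansion M q x c" "c n > 0"
  shows "c n = M" "c (n + k) = M"
proof -
  let ?L = "real M / (q - 1)"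
  have M1: "real M \<ge> 1" using assms(1) by simp
  have qM: "q \<le> real M + 1" using M1 assms(3) by linarith
  note U = U_setD[OF assms(2) qM assms(4,5)]
  have L2: "?L \<ge> 2" using assms(2,3) M1 by (simp add: field_simps)
  have top: "c m = M" if "c m > 0" for m
  proof (rule ccontr)
    assume "c m \<noteq> M"
    then have "c m < M" using is_expansion_le[OF assms(5), of m] by simp
    then show False using U[of m] that L2 by linarith
  qed
  show "c n = M" using top assms(6) .
  have "c (Suc m) = M" if m: "c m > 0" for m
  proof (rule top, rule ccontr)
    assume "\<not> c (Suc m) > 0"
    then have z: "c (Suc m) = 0" by simp
    then have "tail_val c q x (Suc (Suc m)) < 1" using U(1)[of "Suc m"] assms(1) by simp
    then have "q * tail_val c q x (Suc m) < 1" using z by simp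
    moreover have "tail_val c q x (Suc m) > 1" using U(2)[OF m] L2 by linarith
    ultimately show False using assms(2) by (smt (verit) mult_less_cancel_right1)
  qed
  then have "c (n + k) = M" for k
    by (induction k) (use assms(1) \<open>c n = M\<close> in auto)
  then show "c (n + k) = M" .
qed

lemma U_set_small_base:
  assumes "M > 0" "1 < q" "q \<le> 3/2" "x \<in> U_set M q"
  shows "x = 0 \<or> x = real M / (q - 1)"
proof -
  obtain c where c: "is_expansion M q x c"
    using assms(4) unfolding U_set_def by blast
  show ?thesis
  proof (cases "\<forall>i. c i = 0")
    case True
    then have "(\<lambda>_. 0) sums x" using c by (simp add: is_expansion_def)
    then show ?thesis using sums_unique2[OF _ sums_zero] by fastforce
  next
    case False
    then obtain n where n: "c n > 0" by auto
    have "c i = M" for i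
    proof (rule ccontr)
      assume "c i \<noteq> M"
      then have i: "M - c i > 0" using is_expansion_le[OF c, of i] by simp
      \<comment> \<open>Position \<open>i + n\<close> lies behind both \<open>n\<close> and
        \<open>i\<close>: the reflected sequence forces the digit 0 there, \<open>c\<close> itself
        the digit \<open>M\<close>.\<close>
      have "M - c (i + n) = M"
        using U_set_digits_const_of_small_base(2)[OF assms(1-3) U_set_reflect[OF assms(2,4)]
            is_expansion_reflect[OF assms(2) c], of i n] i by simp
      moreover have "c (n + i) = M"
        using U_set_digits_const_of_small_base(2)[OF assms c n] .
      ultimately show False using assms(1) by (simp add: add.commute)
    qed
    then have "c = (\<lambda>_. M)" by auto
    then show ?thesis
      using c is_expansion_top[OF assms(2), of M] sums_unique2 unfolding is_expansion_def by blast
  qed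
qed

text \<open>A tail value 0 behind a positive digit would make that digit the last nonzero one; the
  second claim is the reflected statement.\<close>

lemma doubly_infinite_tail_val_interior:
  assumes "q > 1" "is_expansion M q x c" "doubly_infinite_seq M c"
  shows "c n > 0 \<Longrightarrow> tail_val c q x (Suc n) > 0"
    and "c n < M \<Longrightarrow> tail_val c q x (Suc n) < real M / (q - 1)"
proof -
  have inf: "\<not> finite_seq c" "\<not> finite_seq (\<lambda>i. M - c i)"
    using assms(3) by (auto simp: doubly_infinite_seq_def infinite_seq_def)
  show "tail_val c q x (Suc n) > 0" if "c n > 0"
    using finite_seqI_tail_val[OF assms(1,2) _ that] inf(1)
      tail_val_bounds(1)[OF assms(1,2), of "Suc n"] by force
  show "tail_val c q x (Suc n) < real M / (q - 1)" if "c n < M"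
    using finite_seqI_tail_val[OF assms(1) is_expansion_reflect[OF assms(1,2)], of n] inf(2) that
      tail_val_reflect[of q "Suc n" c M x] assms(1) is_expansion_le[OF assms(2)]
      tail_val_bounds(2)[OF assms(1,2), of "Suc n"] by force
qed

lemma tendsto_tail_val:
  assumes "Q \<longlonglongrightarrow> q" "X \<longlonglongrightarrow> x"
  shows "(\<lambda>m. tail_val c (Q m) (X m) n) \<longlonglongrightarrow> tail_val c q x n"
  by (induction n) (auto intro!: tendsto_intros assms)

lemma U_graph_limit_unique:
  assumes U: "\<And>m. (X m, Q m) \<in> U_graph M" and lim: "Q \<longlonglongrightarrow> q" "X \<longlonglongrightarrow> x" and "1 < q"
    and c: "is_expansion M q x c" "doubly_infinite_seq M c"
    and d: "is_expansion M q x d" "doubly_infinite_seq M d"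
  shows "c = d"
proof (rule ccontr)
  \<comment> \<open>Stated for \<open>c n < d n\<close> in fresh variables, so that it covers both
    orders of the two digits.\<close>
  have key: False if c: "is_expansion M q x c" "doubly_infinite_seq M c"
    and d: "is_expansion M q x d" "doubly_infinite_seq M d"
    and less: "c n < d n"
    and diff: "tail_val c q x (Suc n) - tail_val d q x (Suc n) = real (d n) - real (c n)" for c d n
  proof -
    have "c n < M" "d n > 0" using less is_expansion_le[OF d(1), of n] by auto
    note td = doubly_infinite_tail_val_interior(1)[OF \<open>1 < q\<close> d \<open>d n > 0\<close>]
      and tc = doubly_infinite_tail_val_interior(2)[OF \<open>1 < q\<close> c \<open>c n < M\<close>]
    \<comment> \<open>With \<open>td\<close> and \<open>tc\<close> this places both values strictly
      inside: 0 < tail of \<open>d\<close> < tail of \<open>c\<close> <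
      \<open>M / (q - 1)\<close>.\<close>
    have lt: "tail_val d q x (Suc n) < tail_val c q x (Suc n)" using diff less by linarith
    have LL: "(\<lambda>m. real M / (Q m - 1)) \<longlonglongrightarrow> real M / (q - 1)"
      using \<open>1 < q\<close> lim by (intro tendsto_intros) auto
    have ev: "\<forall>\<^sub>F m in sequentially.
        tail_val e (Q m) (X m) (Suc n) \<in> {0 .. real M / (Q m - 1)}"
      if e: "0 < tail_val e q x (Suc n)" "tail_val e q x (Suc n) < real M / (q - 1)" for e
    proof -
      note te = tendsto_tail_val[OF lim, of e "Suc n"]
      have "\<forall>\<^sub>F m in sequentially. 0 < tail_val e (Q m) (X m) (Suc n)"
        using te e(1) by (rule order_tendstoD)
      moreover have "\<forall>\<^sub>F m in sequentially. 0 < real M / (Q m - 1) - tail_val e (Q m) (X m) (Suc n)"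
        using tendsto_diff[OF LL te] e(2) by (intro order_tendstoD(1)) auto
      ultimately show ?thesis by eventually_elim auto
    qed
    have "\<forall>\<^sub>F m in sequentially. tail_val c (Q m) (X m) (Suc n) \<in> {0 .. real M / (Q m - 1)}
        \<and> tail_val d (Q m) (X m) (Suc n) \<in> {0 .. real M / (Q m - 1)}"
      using td tc lt by (intro eventually_conj ev) auto
    then obtain m where m: "tail_val c (Q m) (X m) (Suc n) \<in> {0 .. real M / (Q m - 1)}"
        "tail_val d (Q m) (X m) (Suc n) \<in> {0 .. real M / (Q m - 1)}"
      by (auto simp: eventually_sequentially simp del: tail_val.simps)
    have Qm: "1 < Q m" "Q m \<le> real M + 1" and Xm: "X m \<in> U_set M (Q m)"
      using U[of m] by (auto simp: U_graph_def)
    obtain c' where c': "is_expansion M (Q m) (X m) c'" "\<And>i. i < Suc n \<Longrightarrow> c' i = c i"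
      using prefix_extends[OF Qm _ m(1)] is_expansion_le[OF c(1)] by metis
    obtain d' where d': "is_expansion M (Q m) (X m) d'" "\<And>i. i < Suc n \<Longrightarrow> d' i = d i"
      using prefix_extends[OF Qm _ m(2)] is_expansion_le[OF d(1)] by metis
    have "c' = d'" using Xm c'(1) d'(1) unfolding U_set_def by blast
    then show False using c'(2)[of n] d'(2)[of n] less by simp
  qed
  assume "c \<noteq> d"
  then obtain n where n: "c n \<noteq> d n"
    "tail_val c q x (Suc n) - tail_val d q x (Suc n) = real (d n) - real (c n)"
    using first_difference[of c d] by metis
  show False
  proof (cases "c n < d n")
    case True
    then show ?thesis using key[OF c d] n(2) by blast
  next
    case False
    then have "d n < c n" using n(1) by simp
    then show ?thesis using key[OF d c] n(2) by (smt (verit))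
  qed
qed

lemma closure_U_graph_subset:
  assumes "M > 0"
  shows "closure (U_graph M) \<subseteq> V_graph M \<union> {(0, 1)}"
proof
  fix p assume "p \<in> closure (U_graph M)"
  then obtain f where f: "\<And>m. f m \<in> U_graph M" "f \<longlonglongrightarrow> p"
    unfolding closure_sequential by blast
  obtain x q where p: "p = (x, q)" by (cases p)
  define X Q where "X = (\<lambda>m. fst (f m))" and "Q = (\<lambda>m. snd (f m))"
  have U: "(X m, Q m) \<in> U_graph M" for m using f(1) by (simp add: X_def Q_def)
  have lim: "Q \<longlonglongrightarrow> q" "X \<longlonglongrightarrow> x"
    using tendsto_snd[OF f(2)] tendsto_fst[OF f(2)] by (auto simp: X_def Q_def p)
  have Qb: "1 < Q m" "Q m \<le> real M + 1" and Xb: "X m \<in> U_set M (Q m)" for m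
    using U[of m] by (auto simp: U_graph_def)
  have XJ: "0 \<le> X m" "X m \<le> real M / (Q m - 1)" for m
    using Xb[of m] by (auto simp: U_set_def J_set_def)
  have q: "1 \<le> q" "q \<le> real M + 1"
    using Qb LIMSEQ_le_const[OF lim(1)] LIMSEQ_le_const2[OF lim(1)] by (meson less_imp_le)+
  show "p \<in> V_graph M \<union> {(0, 1)}"
  proof (cases "q = 1")
    case True
    \<comment> \<open>At the right end point this product equals \<open>M > 0\<close>; since it
      tends to 0, \<open>X m\<close> is eventually the left end point.\<close>
    have XQ: "(\<lambda>m. X m * (Q m - 1)) \<longlonglongrightarrow> x * (1 - 1)"
      using lim True by (intro tendsto_intros) auto
    have ev1: "\<forall>\<^sub>F m in sequentially. Q m < 3/2"
      using lim(1) True by (intro order_tendstoD(2)[of Q 1]) auto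
    have ev2: "\<forall>\<^sub>F m in sequentially. X m * (Q m - 1) < real M"
      using XQ assms by (intro order_tendstoD(2)[OF XQ]) auto
    have "\<forall>\<^sub>F m in sequentially. X m = 0"
      using ev1 ev2
    proof eventually_elim
      case (elim m)
      have "X m = 0 \<or> X m = real M / (Q m - 1)"
        using U_set_small_base[OF assms Qb(1) _ Xb] elim(1) by simp
      then show ?case using elim(2) Qb(1)[of m] by auto
    qed
    then have "X \<longlonglongrightarrow> 0" by (rule tendsto_eventually)
    then have "x = 0" using lim(2) LIMSEQ_unique by blast
    then show ?thesis using p True by simp
  next
    case False
    then have q1: "1 < q" using q by simp
    have x0: "0 \<le> x" using LIMSEQ_le_const[OF lim(2)] XJ by blast
    have "(\<lambda>m. real M / (Q m - 1)) \<longlonglongrightarrow> real M / (q - 1)"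
      using q1 lim by (intro tendsto_intros) auto
    then have xL: "x \<le> real M / (q - 1)"
      using LIMSEQ_le[OF lim(2)] XJ by blast
    have "x \<in> V_set M q"
    proof (cases "q = real M + 1")
      case True
      then show ?thesis using x0 xL assms by (simp add: V_set_def)
    next
      case False
      then have "q < real M + 1" using q by simp
      then obtain c where c: "is_expansion M q x c" "doubly_infinite_seq M c"
        using doubly_infinite_expansion_exists[OF q1] x0 xL by auto
      then have "\<exists>!c. is_expansion M q x c \<and> doubly_infinite_seq M c"
        using U_graph_limit_unique[OF U lim q1] by blast
      then show ?thesis using False x0 xL by (simp add: V_set_def J_set_def)
    qed
    then show ?thesis using p q1 q by (simp add: V_graph_def)
  qed
qed

section \<open>Approximation by univoque points\<close>

lemma expansion_value_exists:
  assumes "q > 1" "\<And>i. c i \<le> M"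
  shows "is_expansion M q (\<Sum>i. real (c i) / q ^ Suc i) c"
proof -
  have "summable (\<lambda>i. real M / q ^ Suc i)"
    using is_expansion_top[OF assms(1)] by (auto simp: is_expansion_def sums_iff)
  then have "summable (\<lambda>i. real (c i) / q ^ Suc i)"
    by (rule summable_comparison_test'[where N = 0])
      (use assms in \<open>auto intro!: divide_right_mono\<close>)
  then show ?thesis using assms(2) by (auto simp: is_expansion_def digit_seqs_def summable_sums)
qed

text \<open>Enlarging the base shrinks every term with a nonzero digit. The conclusion is
  \<open>y' < 1\<close> and not \<open>y' < y\<close> because the zero sequence has value 0 in both
  bases.\<close>

lemma is_expansion_strict_antimono:
  assumes "1 < q" "q < q'" "is_expansion M q y c" "is_expansion M q' y' c" "y \<le> 1"
  shows "y' < 1"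
proof (cases "\<forall>i. c i = 0")
  case True
  then have "(\<lambda>_. 0) sums y'" using assms(4) by (simp add: is_expansion_def)
  then show ?thesis using sums_unique2[OF _ sums_zero] by fastforce
next
  case False
  then obtain k where k: "c k > 0" by auto
  have pw: "q ^ Suc i < q' ^ Suc i" for i
    using assms(1,2) by (intro power_strict_mono) auto
  have pos: "0 < q ^ Suc i" for i using assms(1) by simp
  have s: "(\<lambda>i. real (c i) / q ^ Suc i - real (c i) / q' ^ Suc i) sums (y - y')"
    using assms(3,4) by (intro sums_diff) (auto simp: is_expansion_def)
  have "0 < (\<Sum>i. real (c i) / q ^ Suc i - real (c i) / q' ^ Suc i)"
  proof (rule suminf_pos2[where i = k])
    show "summable (\<lambda>i. real (c i) / q ^ Suc i - real (c i) / q' ^ Suc i)"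
      using s by (rule sums_summable)
    show "0 \<le> real (c i) / q ^ Suc i - real (c i) / q' ^ Suc i" for i
      using divide_left_mono[of "q ^ Suc i" "q' ^ Suc i" "real (c i)"] pw[of i] pos[of i]
        assms(1,2) by simp
    show "0 < real (c k) / q ^ Suc k - real (c k) / q' ^ Suc k"
      using divide_strict_left_mono[of "q ^ Suc k" "q' ^ Suc k" "real (c k)"] pw[of k] pos[of k]
        assms(1,2) k by simp
  qed
  then show ?thesis using s assms(5) by (simp add: sums_iff)
qed

text \<open>Monotonicity in the base turns the bounds of \<open>V_setD\<close> into those of
  \<open>U_setI\<close>. The lower digit condition concerns the value of the reflected tail, so the
  change of \<open>M / (q - 1)\<close> is accounted for.\<close>

lemma V_set_imp_U_set_larger_base:
  assumes "1 < q" "q < real M + 1" "x \<in> V_set M q"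
    and c: "is_expansion M q x c" "doubly_infinite_seq M c"
    and "q < q'" "is_expansion M q' x' c"
  shows "x' \<in> U_set M q'"
proof (rule U_setI)
  show "q' > 1" using assms by simp
  show "is_expansion M q' x' c" by fact
  fix n
  have t: "is_expansion M q (tail_val c q x (Suc n)) (\<lambda>i. c (i + Suc n))"
    using is_expansion_shift[OF \<open>1 < q\<close>] c(1) by blast
  have t': "is_expansion M q' (tail_val c q' x' (Suc n)) (\<lambda>i. c (i + Suc n))"
    using is_expansion_shift[OF \<open>q' > 1\<close>] assms(7) by blast
  show "tail_val c q' x' (Suc n) < 1" if "c n < M"
    using is_expansion_strict_antimono[OF assms(1,6) t t'] V_setD(1)[OF assms(1-3) c that] by blast
  show "real M / (q' - 1) - tail_val c q' x' (Suc n) < 1" if "c n > 0"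
    using is_expansion_strict_antimono[OF assms(1,6) is_expansion_reflect[OF assms(1) t]
        is_expansion_reflect[OF \<open>q' > 1\<close> t']] V_setD(2)[OF assms(1-3) c that] by blast
qed

lemma isCont_expansion_value:
  assumes "q > 1" "\<And>i. c i \<le> M"
  shows "isCont (\<lambda>q. \<Sum>i. real (c i) / q ^ Suc i) q"
proof -
  \<comment> \<open>Any base strictly between 1 and \<open>q\<close> would do: the power series
    converges at \<open>1 / r\<close>, and \<open>1 / q\<close> is strictly inside its disc.\<close>
  define r where "r = (q + 1) / 2"
  have r: "1 < r" "r < q" using assms(1) by (auto simp: r_def)
  have pow: "real (c i) * (1 / s) ^ Suc i = real (c i) / s ^ Suc i" for s i
    by (simp add: power_divide)
  have sm: "summable (\<lambda>i. real (c i) * (1 / r) ^ Suc i)"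
    using expansion_value_exists[of r c M, OF r(1) assms(2)]
    unfolding is_expansion_def pow by (auto simp: sums_iff)
  \<comment> \<open>A zero constant term is prepended because the exponents of an expansion start at
    1.\<close>
  define b where "b = (\<lambda>n. case n of 0 \<Rightarrow> 0 | Suc i \<Rightarrow> real (c i))"
  have b: "b 0 = 0" "\<And>i. b (Suc i) = real (c i)" by (auto simp: b_def)
  have smb: "summable (\<lambda>n. b n * (1 / r) ^ n)"
    by (subst summable_Suc_iff[symmetric]) (use sm in \<open>simp add: b\<close>)
  have cont: "isCont (\<lambda>z. \<Sum>n. b n * z ^ n) (1 / q)"
    using isCont_powser[OF smb, of "1 / q"] r by (simp add: field_simps)
  have eq: "(\<Sum>n. b n * (1 / s) ^ n) = (\<Sum>i. real (c i) / s ^ Suc i)" if "s > 1" for s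
  proof -
    have "(\<lambda>i. real (c i) / s ^ Suc i) sums (\<Sum>i. real (c i) / s ^ Suc i)"
      using expansion_value_exists[of s c M, OF that assms(2)] by (simp add: is_expansion_def)
    then have "(\<lambda>i. b (Suc i) * (1 / s) ^ Suc i) sums (\<Sum>i. real (c i) / s ^ Suc i)"
      unfolding b pow .
    then show ?thesis
      using sums_Suc[of "\<lambda>n. b n * (1 / s) ^ n"] b(1) by (simp add: sums_iff)
  qed
  have "isCont (\<lambda>s. 1 / s) q"
    using assms(1) by (intro continuous_intros) auto
  then have "isCont (\<lambda>s. \<Sum>n. b n * (1 / s) ^ n) q"
    using cont by (rule isCont_o2)
  moreover have "\<forall>\<^sub>F s in nhds q. s \<in> {1<..}"
    using assms(1) by (intro eventually_nhds_in_open) auto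
  then have "\<forall>\<^sub>F s in nhds q. (\<Sum>n. b n * (1 / s) ^ n) = (\<Sum>i. real (c i) / s ^ Suc i)"
    by eventually_elim (use eq in auto)
  ultimately show ?thesis by (simp add: isCont_cong)
qed

lemma V_set_subset_closure:
  assumes "1 < q" "q < real M + 1" "x \<in> V_set M q"
  shows "(x, q) \<in> closure (U_graph M)"
proof -
  obtain c where c: "is_expansion M q x c" "doubly_infinite_seq M c"
    using assms unfolding V_set_def by auto
  define v where "v = (\<lambda>q. \<Sum>i. real (c i) / q ^ Suc i)"
  \<comment> \<open>The bases decrease to \<open>q\<close> from the admissible maximum
    \<open>Q 0 = M + 1\<close>, while the digits \<open>c\<close> stay fixed.\<close>
  define Q where "Q = (\<lambda>m. q + (real M + 1 - q) / real (Suc m))"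
  have Q: "q < Q m" "Q m \<le> real M + 1" for m
  proof -
    show "q < Q m" using assms(2) unfolding Q_def by simp
    have "(real M + 1 - q) / real (Suc m) \<le> (real M + 1 - q) / 1"
      using assms(2) by (intro divide_left_mono) auto
    then show "Q m \<le> real M + 1" unfolding Q_def by simp
  qed
  have "(\<lambda>m. q + (real M + 1 - q) * inverse (real (Suc m))) \<longlonglongrightarrow> q + (real M + 1 - q) * 0"
    by (intro tendsto_intros LIMSEQ_inverse_real_of_nat)
  then have Qlim: "Q \<longlonglongrightarrow> q" unfolding Q_def by (simp add: divide_inverse)
  have "isCont v q"
    unfolding v_def using isCont_expansion_value[OF assms(1)] is_expansion_le[OF c(1)] by blast
  then have "(\<lambda>m. v (Q m)) \<longlonglongrightarrow> v q" using Qlim isCont_tendsto_compose by blast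
  moreover have "v q = x" using c(1) by (simp add: v_def is_expansion_def sums_iff)
  ultimately have "(\<lambda>m. (v (Q m), Q m)) \<longlonglongrightarrow> (x, q)" using Qlim by (intro tendsto_Pair) auto
  moreover have "(v (Q m), Q m) \<in> U_graph M" for m
  proof -
    have "is_expansion M (Q m) (v (Q m)) c"
      unfolding v_def using expansion_value_exists is_expansion_le[OF c(1)] Q(1)[of m] assms(1)
      by simp
    then have "v (Q m) \<in> U_set M (Q m)"
      using V_set_imp_U_set_larger_base[OF assms c Q(1)] by blast
    then show ?thesis using Q[of m] assms(1) by (simp add: U_graph_def)
  qed
  ultimately show ?thesis unfolding closure_sequential by (intro exI[of _ "\<lambda>m. (v (Q m), Q m)"]) auto
qed

section \<open>The base \<open>M + 1\<close> and the limit point \<open>(0, 1)\<close>\<close>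

lemma Rats_of_tail_val_Rats:
  assumes "q \<in> \<rat>" "q \<noteq> 0" "tail_val c q x n \<in> \<rat>"
  shows "x \<in> \<rat>"
  using assms(3)
proof (induction n)
  case (Suc n)
  have "(q * tail_val c q x n - real (c n) + real (c n)) / q \<in> \<rat>"
    using Suc.prems assms(1) by (intro Rats_divide Rats_add) auto
  then show ?case using Suc.IH assms(2) by simp
qed simp

text \<open>Here \<open>L = 1\<close>. No tail value can be 0 or 1, as \<open>x\<close> would be
  rational; all of them lie strictly in between, which is what \<open>U_setI\<close> asks
  for.\<close>

lemma irrational_in_U_set:
  assumes "M > 0" "x \<in> {0..1}" "x \<notin> \<rat>"
  shows "x \<in> U_set M (real M + 1)"
proof -
  let ?q = "real M + 1"
  have q: "1 < ?q" "?q \<in> \<rat>" "?q \<noteq> 0" using assms(1) by auto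
  have L: "real M / (?q - 1) = 1" using assms(1) by simp
  obtain c where c: "is_expansion M ?q x c"
    using expansion_exists[OF q(1), of M x] assms(2) L by auto
  have ne: "tail_val c ?q x n \<notin> {0, 1}" for n
    using Rats_of_tail_val_Rats[OF q(2,3), of c x n] assms(3) by fastforce
  have "0 < tail_val c ?q x n \<and> tail_val c ?q x n < 1" for n
    using tail_val_bounds[OF q(1) c, of n] ne[of n] unfolding L by force
  then show ?thesis
    using U_setI[OF q(1) c] unfolding L by (metis diff_less_eq less_add_same_cancel1)
qed

lemma top_base_subset_closure:
  assumes "M > 0" "x \<in> {0..1}"
  shows "(x, real M + 1) \<in> closure (U_graph M)"
proof -
  let ?I = "{0<..<1} \<inter> (- \<rat>) :: real set"
  \<comment> \<open>The rationals are countable and so contain no nonempty open set; hence the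
    irrationals are dense.\<close>
  have "interior (\<rat> :: real set) = {}"
    using countable_rat open_minus_countable[of \<rat> "interior \<rat>"] interior_subset by blast
  then have "closure (- \<rat> :: real set) = UNIV" by (simp add: closure_complement)
  then have "closure ?I = closure {0<..<1}"
    by (intro closure_open_Int_superset) auto
  then have "x \<in> closure ?I" using assms(2) by simp
  then obtain X where X: "\<And>m. X m \<in> ?I" "X \<longlonglongrightarrow> x"
    unfolding closure_sequential by blast
  have "(X m, real M + 1) \<in> U_graph M" for m
    using X(1)[of m] irrational_in_U_set[OF assms(1), of "X m"] assms(1) by (auto simp: U_graph_def)
  moreover have "(\<lambda>m. (X m, real M + 1)) \<longlonglongrightarrow> (x, real M + 1)"
    using X(2) by (intro tendsto_intros)
  ultimately show ?thesis
    unfolding closure_sequential by (intro exI[of _ "\<lambda>m. (X m, real M + 1)"]) auto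
qed

text \<open>The point 0 is univoque in every base, and the bases can decrease to 1.\<close>

lemma zero_one_in_closure:
  assumes "M > 0"
  shows "(0, 1) \<in> closure (U_graph M)"
proof -
  let ?Q = "\<lambda>m. 1 + inverse (real (Suc m))"
  have "?Q \<longlonglongrightarrow> 1 + 0" by (intro tendsto_intros LIMSEQ_inverse_real_of_nat)
  then have "(\<lambda>m. (0 :: real, ?Q m)) \<longlonglongrightarrow> (0, 1)" by (intro tendsto_Pair) auto
  moreover have "(0, ?Q m) \<in> U_graph M" for m
  proof -
    have "inverse (real (Suc m)) \<le> 1" by (simp add: field_simps)
    moreover have "1 \<le> real M" using assms by simp
    ultimately have "inverse (real (Suc m)) \<le> real M" by linarith
    moreover have q: "1 < ?Q m" by simp
    moreover have "0 \<in> U_set M (?Q m)"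
      using is_expansion_0_iff[OF q, of M] by (auto simp: U_set_def J_set_def)
    ultimately show ?thesis by (simp add: U_graph_def)
  qed
  ultimately show ?thesis
    unfolding closure_sequential by (intro exI[of _ "\<lambda>m. (0, ?Q m)"]) auto
qed

theorem theorem1p13:
  fixes M :: nat
  assumes "M > 0"
  shows "\<not> closed (U_graph M) \<and> closure (U_graph M) = V_graph M \<union> {(0, 1)}"
proof
  have "(0, 1) \<notin> U_graph M" by (simp add: U_graph_def)
  then show "\<not> closed (U_graph M)"
    using zero_one_in_closure[OF assms] closure_closed by blast
  have "(x, q) \<in> closure (U_graph M)" if "(x, q) \<in> V_graph M" for x q
  proof (cases "q = real M + 1")
    case True
    then show ?thesis
      using that top_base_subset_closure[OF assms] by (auto simp: V_graph_def V_set_def)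
  next
    case False
    then show ?thesis
      using that V_set_subset_closure[of q M x] by (auto simp: V_graph_def)
  qed
  then show "closure (U_graph M) = V_graph M \<union> {(0, 1)}"
    using closure_U_graph_subset[OF assms] zero_one_in_closure[OF assms] by auto
qed

end
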